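(* Let $\Gamma$ be an infinite, connected, locally finite graph of linear volume growth, with a fixed base vertex $o \in \Gamma$. Then the set of horofunctions $\{ f_\omega : \omega \text{ a geodesic ray in } \Gamma \}$ on $\Gamma$ is finite.
   Context: Let $\Gamma$ be an infinite, connected, locally finite graph, identified with its vertex set, let $d(\cdot,\cdot)$ be its graph metric, and fix a vertex $o \in \Gamma$. $\Gamma$ has linear volume growth if the balls about $o$ grow at most linearly in the radius, i.e. there is a constant $C$ such that $|\{x \in \Gamma : d(o,x) \le r\}| \le C r$ for all integers $r \ge 1$. For $z \in \Gamma$, the Busemann function $b_z : \Gamma \to \mathbb{Z}$ is defined by $b_z(y) = d(z,y) - d(z,o)$. A geodesic ray in $\Gamma$ is an infinite sequence of vertices $\omega = (z_1, z_2, \ldots)$, starting at an arbitrary vertex, with $d(z_i,z_j) = |i-j|$ for all $i,j$. For a geodesic ray $\omega = (z_1,z_2,\ldots)$, the horofunction $f_\omega : \Gamma \to \mathbb{Z}$ is defined by $f_\omega(y) = \lim_{n\to\infty} b_{z_n}(y)$; it is a standard fact that this limit exists. *)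

theory Defs
  imports Complex_Main
begin

text \<open>
  A graph is given by its adjacency relation on a type \<^typ>\<open>'a\<close>, the whole type being the
  vertex set, so that functions on the graph are functions on \<^typ>\<open>'a\<close>.
\<close>

definition simple_graph :: "('a \<Rightarrow> 'a \<Rightarrow> bool) \<Rightarrow> bool" where
  "simple_graph adj \<longleftrightarrow> symp adj \<and> irreflp adj"

definition graph_connected :: "('a \<Rightarrow> 'a \<Rightarrow> bool) \<Rightarrow> bool" where
  "graph_connected adj \<longleftrightarrow> (\<forall>x y. adj\<^sup>*\<^sup>* x y)"

definition locally_finite_graph :: "('a \<Rightarrow> 'a \<Rightarrow> bool) \<Rightarrow> bool" where
  "locally_finite_graph adj \<longleftrightarrow> (\<forall>x. finite {y. adj x y})"

text \<open>
  \<open>(adj ^^ n) x y\<close> says that there is a walk of length \<open>n\<close> from \<open>x\<close> to \<open>y\<close>.  The distance is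
  meaningful only between vertices joined by some walk, hence always in a connected graph.
\<close>

definition graph_dist :: "('a \<Rightarrow> 'a \<Rightarrow> bool) \<Rightarrow> 'a \<Rightarrow> 'a \<Rightarrow> nat" where
  "graph_dist adj x y = (LEAST n. (adj ^^ n) x y)"

text \<open>
  In a connected locally finite graph all balls are finite, so the convention that an infinite
  set has \<^const>\<open>card\<close> zero plays no role there.
\<close>

definition linear_volume_growth :: "('a \<Rightarrow> 'a \<Rightarrow> bool) \<Rightarrow> 'a \<Rightarrow> bool" where
  "linear_volume_growth adj p \<longleftrightarrow>
     (\<exists>C::real. \<forall>r::nat. r \<ge> 1 \<longrightarrow> real (card {x. graph_dist adj p x \<le> r}) \<le> C * real r)"

definition busemann :: "('a \<Rightarrow> 'a \<Rightarrow> bool) \<Rightarrow> 'a \<Rightarrow> 'a \<Rightarrow> 'a \<Rightarrow> int" where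
  "busemann adj p z y = int (graph_dist adj z y) - int (graph_dist adj z p)"

text \<open>Rays are indexed from \<open>0\<close> rather than from \<open>1\<close>.\<close>

definition geodesic_ray :: "('a \<Rightarrow> 'a \<Rightarrow> bool) \<Rightarrow> (nat \<Rightarrow> 'a) \<Rightarrow> bool" where
  "geodesic_ray adj w \<longleftrightarrow> (\<forall>i j. int (graph_dist adj (w i) (w j)) = \<bar>int i - int j\<bar>)"

text \<open>The limit is taken in the discrete space \<^typ>\<open>int\<close>; it exists for every geodesic ray
  in a connected graph.\<close>

definition horofunction :: "('a \<Rightarrow> 'a \<Rightarrow> bool) \<Rightarrow> 'a \<Rightarrow> (nat \<Rightarrow> 'a) \<Rightarrow> 'a \<Rightarrow> int" where
  "horofunction adj p w y = lim (\<lambda>n. busemann adj p (w n) y)"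

end

theory Submission
  imports Defs
begin

text \<open>
  Let \<open>S r\<close> be the sphere of radius \<open>r\<close> about the base vertex.  A geodesic ray \<open>w\<close> eventually
  moves away from the base vertex at unit speed, because the distance from \<open>w n\<close> to any fixed
  vertex is \<open>n\<close> plus a constant for large \<open>n\<close> (lemma \<open>ray_dist_eventually_shift\<close>).  It therefore
  has exactly one late vertex \<open>v r\<close> on every sphere \<open>S r\<close> with \<open>r\<close> large, and its horofunction at
  \<open>y\<close> is the value of the Busemann function of \<open>v r\<close> at \<open>y\<close> for all large \<open>r\<close> (lemma
  \<open>horofunction_via_spheres\<close>).

  Consequently two rays whose late vertices on \<open>S r\<close> agree for infinitely many \<open>r\<close> have the same
  horofunction.  Turned around, \<open>k\<close> distinct horofunctions yield \<open>k\<close> distinct vertices on \<open>S r\<close> for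
  every large \<open>r\<close> (lemma \<open>card_horofunctions_le_sphere\<close>).  Linear volume growth bounds the average
  size of the spheres, so some constant bounds the size of infinitely many of them (lemma
  \<open>bounded_spheres\<close>).  That constant also bounds the number of horofunctions.
\<close>

context
  fixes adj :: "'a \<Rightarrow> 'a \<Rightarrow> bool"
  assumes sym: "symp adj" and conn: "graph_connected adj"
begin

abbreviation d :: "'a \<Rightarrow> 'a \<Rightarrow> nat" where "d \<equiv> graph_dist adj"

lemma walk_of_length_dist: "(adj ^^ d x y) x y"
proof -
  have "\<exists>n. (adj ^^ n) x y"
    using conn by (simp add: graph_connected_def rtranclp_power)
  then show ?thesis
    unfolding graph_dist_def by (rule LeastI_ex)
qed

lemma dist_le_walk: "(adj ^^ n) x y \<Longrightarrow> d x y \<le> n"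
  unfolding graph_dist_def by (rule Least_le)

lemma dist_triangle: "d x z \<le> d x y + d y z"
proof (rule dist_le_walk)
  show "(adj ^^ (d x y + d y z)) x z"
    unfolding relpowp_add using walk_of_length_dist by (rule relcomppI) (rule walk_of_length_dist)
qed

lemma walk_reverse: "(adj ^^ n) x y \<Longrightarrow> (adj ^^ n) y x"
proof (induction n arbitrary: y)
  case (Suc n)
  from Suc.prems obtain z where z: "(adj ^^ n) x z" "adj z y"
    by (rule relpowp_Suc_E)
  show ?case
    by (rule relpowp_Suc_I2[OF sympD[OF sym z(2)] Suc.IH[OF z(1)]])
qed simp

lemma dist_sym: "d x y = d y x"
  by (rule antisym; rule dist_le_walk, rule walk_reverse, rule walk_of_length_dist)

text \<open>
  By the triangle inequality the integers \<open>d (w n) y - n\<close> decrease with \<open>n\<close> and are bounded below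
  by \<open>- d (w 0) y\<close>, so they are eventually constant.
\<close>

lemma ray_dist_eventually_shift:
  assumes "geodesic_ray adj w"
  shows "\<exists>c. \<forall>\<^sub>F n in sequentially. int (d (w n) y) = int n + c"
proof -
  have w: "int (d (w i) (w j)) = \<bar>int i - int j\<bar>" for i j
    using assms by (simp add: geodesic_ray_def)
  have low: "n \<le> d (w n) y + d (w 0) y" for n
    using dist_triangle[of "w 0" "w n" y] w[of 0 n] dist_sym[of "w n" y] by simp
  have dec: "d (w n) y + m \<le> d (w m) y + n" if "m \<le> n" for m n
    using dist_triangle[of "w n" y "w m"] w[of n m] that by simp
  define g where "g n = d (w n) y + d (w 0) y - n" for n
  obtain m where m: "\<And>n. g m \<le> g n"
    using ex_has_least_nat[of "\<lambda>_. True" 0 g] by auto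
  have "int (d (w n) y) = int n + (int (d (w m) y) - int m)" if "m \<le> n" for n
  proof -
    have "d (w m) y + n \<le> d (w n) y + m"
      using m[of n] low[of n] low[of m] by (simp add: g_def)
    with dec[OF that] show ?thesis by linarith
  qed
  then have "\<forall>\<^sub>F n in sequentially. int (d (w n) y) = int n + (int (d (w m) y) - int m)"
    by (rule eventually_sequentiallyI)
  then show ?thesis ..
qed

text \<open>
  Reparametrising a ray by the distance from \<open>p\<close> removes the dependence on its starting vertex,
  so that rays become comparable sphere by sphere.
\<close>

lemma horofunction_via_spheres:
  assumes "geodesic_ray adj w"
  obtains v where "\<forall>\<^sub>F r in sequentially. d p (v r) = r"
    and "\<And>y. \<forall>\<^sub>F r in sequentially. busemann adj p (v r) y = horofunction adj p w y"
proof -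
  obtain c where c: "\<forall>\<^sub>F n in sequentially. int (d (w n) p) = int n + c"
    using ray_dist_eventually_shift[OF assms] by blast
  define k where "k r = nat (int r - c)" for r
  have k: "filterlim k sequentially sequentially"
    unfolding filterlim_at_top eventually_sequentially
  proof (intro allI exI impI)
    fix Z r :: nat assume "Z + nat \<bar>c\<bar> \<le> r"
    then show "Z \<le> k r" unfolding k_def by linarith
  qed
  have "\<forall>\<^sub>F r in sequentially. int (d (w (k r)) p) = int (k r) + c"
    using eventually_compose_filterlim[OF c k] .
  moreover have "\<forall>\<^sub>F r in sequentially. nat \<bar>c\<bar> \<le> r"
    by (rule eventually_ge_at_top)
  ultimately have sphere: "\<forall>\<^sub>F r in sequentially. d p (w (k r)) = r"
    by eventually_elim (unfold k_def dist_sym[of p], linarith)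
  have "\<forall>\<^sub>F r in sequentially. busemann adj p (w (k r)) y = horofunction adj p w y" for y
  proof -
    obtain e where "\<forall>\<^sub>F n in sequentially. int (d (w n) y) = int n + e"
      using ray_dist_eventually_shift[OF assms] by blast
    with c have ev: "\<forall>\<^sub>F n in sequentially. busemann adj p (w n) y = e - c"
      by eventually_elim (simp add: busemann_def)
    then have "(\<lambda>n. busemann adj p (w n) y) \<longlonglongrightarrow> e - c"
      by (rule tendsto_eventually)
    then have "horofunction adj p w y = e - c"
      unfolding horofunction_def by (rule limI)
    then show ?thesis
      using eventually_compose_filterlim[OF ev k] by simp
  qed
  with sphere show ?thesis by (rule that)
qed

lemma finite_ball:
  assumes "locally_finite_graph adj"
  shows "finite {x. d p x \<le> r}"
proof -
  have walks: "finite {x. (adj ^^ n) p x}" for n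
  proof (induction n)
    case (Suc n)
    have "{x. (adj ^^ Suc n) p x} = (\<Union>y\<in>{y. (adj ^^ n) p y}. {x. adj y x})"
      by auto
    with Suc assms show ?case by (simp add: locally_finite_graph_def)
  qed simp
  have "{x. d p x \<le> r} \<subseteq> (\<Union>n\<le>r. {x. (adj ^^ n) p x})"
    using walk_of_length_dist by blast
  then show ?thesis
    by (rule finite_subset) (simp add: walks)
qed

text \<open>
  If all spheres of radius beyond \<open>R\<close> had more than \<open>K\<close> vertices, the volume of the balls would
  grow at rate at least \<open>K + 1\<close>, which is too fast when \<open>K\<close> bounds the growth constant.
\<close>

lemma bounded_spheres:
  assumes "locally_finite_graph adj" and "linear_volume_growth adj p"
  obtains K where "\<And>R. \<exists>r\<ge>R. card {x. d p x = r} \<le> K"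
proof -
  let ?B = "\<lambda>r. {x. d p x \<le> r}" and ?S = "\<lambda>r. {x. d p x = r}"
  obtain C :: real where C: "\<And>r. r \<ge> 1 \<Longrightarrow> real (card (?B r)) \<le> C * real r"
    using assms(2) by (auto simp: linear_volume_growth_def)
  define K where "K = nat \<lceil>C\<rceil>"
  have K: "card (?B r) \<le> K * r" if "r \<ge> 1" for r
  proof -
    have "C \<le> real K" unfolding K_def by linarith
    then have "real (card (?B r)) \<le> real K * real r"
      using C[OF that] by (meson mult_right_mono of_nat_0_le_iff order_trans)
    then show ?thesis by (metis of_nat_le_iff of_nat_mult)
  qed
  have ball_Suc: "card (?B (Suc r)) = card (?B r) + card (?S (Suc r))" for r
  proof -
    have eq: "?B (Suc r) = ?B r \<union> ?S (Suc r)" by auto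
    have "finite (?S (Suc r))"
      by (rule finite_subset[OF _ finite_ball[OF assms(1), of p "Suc r"]]) auto
    then show ?thesis
      unfolding eq by (intro card_Un_disjoint finite_ball assms(1)) auto
  qed
  have "\<exists>r\<ge>R. card (?S r) \<le> K" for R
  proof (rule ccontr)
    assume "\<not> ?thesis"
    then have big: "Suc K \<le> card (?S r)" if "R \<le> r" for r
      using that by (meson not_less_eq_eq)
    have growth: "n * Suc K \<le> card (?B (R + n))" for n
    proof (induction n)
      case (Suc n)
      with ball_Suc[of "R + n"] big[of "Suc (R + n)"] show ?case by simp
    qed simp
    \<comment> \<open>the first \<open>n\<close> with \<open>n * (K + 1) > K * (R + n)\<close>\<close>
    define n where "n = Suc (K * R)"
    have "n * Suc K \<le> K * (R + n)"
      using growth[of n] K[of "R + n"] by (simp add: n_def)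
    then show False
      by (simp add: n_def algebra_simps)
  qed
  then show ?thesis by (rule that)
qed

text \<open>
  On a large enough sphere the late vertices of the chosen rays separate the given horofunctions:
  each pair of horofunctions differs at some \<open>y\<close>, and there the Busemann functions of the two
  vertices already have their limiting values.
\<close>

lemma card_horofunctions_le_sphere:
  assumes "locally_finite_graph adj"
    and "finite F" and "F \<subseteq> {horofunction adj p w | w. geodesic_ray adj w}"
  shows "\<forall>\<^sub>F r in sequentially. card F \<le> card {x. d p x = r}"
proof -
  have "\<exists>v. (\<forall>\<^sub>F r in sequentially. d p (v r) = r) \<and>
            (\<forall>y. \<forall>\<^sub>F r in sequentially. busemann adj p (v r) y = h y)" if h: "h \<in> F" for h
  proof -
    obtain w where "geodesic_ray adj w" "h = horofunction adj p w"
      using h assms(3) by blast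
    then show ?thesis
      using horofunction_via_spheres[of w p] by metis
  qed
  then obtain v
    where sphere: "\<And>h. h \<in> F \<Longrightarrow> \<forall>\<^sub>F r in sequentially. d p (v h r) = r"
      and limit: "\<And>h y. h \<in> F \<Longrightarrow> \<forall>\<^sub>F r in sequentially. busemann adj p (v h r) y = h y"
    by metis
  have distinct: "\<forall>\<^sub>F r in sequentially. v h r = v h' r \<longrightarrow> h = h'"
    if "h \<in> F" "h' \<in> F" for h h'
  proof (cases "h = h'")
    case False
    then obtain y where y: "h y \<noteq> h' y" by blast
    with limit[OF that(1), of y] limit[OF that(2), of y] show ?thesis
      by eventually_elim (use y in auto)
  qed simp
  have "\<forall>\<^sub>F r in sequentially. \<forall>h\<in>F. d p (v h r) = r"
    using assms(2) sphere by (simp add: eventually_ball_finite_distrib)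
  moreover have "\<forall>\<^sub>F r in sequentially. \<forall>h\<in>F. \<forall>h'\<in>F. v h r = v h' r \<longrightarrow> h = h'"
    using assms(2) distinct by (simp add: eventually_ball_finite_distrib)
  ultimately show ?thesis
  proof eventually_elim
    case (elim r)
    have "finite {x. d p x = r}"
      by (rule finite_subset[OF _ finite_ball[OF assms(1), of p r]]) auto
    with elim show ?case
      by (intro card_inj_on_le[where f = "\<lambda>h. v h r"]) (auto simp: inj_on_def)
  qed
qed

end

theorem theorem1p1:
  fixes adj :: "'a \<Rightarrow> 'a \<Rightarrow> bool" and p :: 'a
  assumes "simple_graph adj"
    and "infinite (UNIV :: 'a set)"
    and "graph_connected adj"
    and "locally_finite_graph adj"
    and "linear_volume_growth adj p"
  shows "finite {horofunction adj p w | w. geodesic_ray adj w}"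
proof (rule ccontr)
  have sym: "symp adj" using assms(1) by (simp add: simple_graph_def)
  obtain K where K: "\<And>R. \<exists>r\<ge>R. card {x. graph_dist adj p x = r} \<le> K"
    using bounded_spheres[OF sym assms(3-5)] by blast
  assume "infinite {horofunction adj p w | w. geodesic_ray adj w}"
  then obtain F where F: "finite F" "card F = Suc K"
      "F \<subseteq> {horofunction adj p w | w. geodesic_ray adj w}"
    using infinite_arbitrarily_large by blast
  then obtain R where "\<And>r. R \<le> r \<Longrightarrow> Suc K \<le> card {x. graph_dist adj p x = r}"
    using card_horofunctions_le_sphere[OF sym assms(3,4) F(1,3)]
    by (auto simp: eventually_sequentially)
  with K[of R] show False by (meson not_less_eq_eq)
qed

end
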